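(* For every integer $k\ge 0$, the following identity of formal power series in $p$ (with coefficients in $\mathbb{Z}[q,t,u,v]$) holds: $$\sum_{\sigma\in\mathbf{C}_{k}}p^{|\sigma|}q^{\operatorname{inv}(\sigma)}t^{\operatorname{comaj}(\sigma)}u^{\operatorname{maj}(\sigma)}v^{\operatorname{des}(\sigma)}=\frac{p^k}{(p)_k}\sum_{\pi\in\mathbf{S}_k}p^{\operatorname{maj}(\pi)}q^{\operatorname{inv}(\pi)}t^{\operatorname{imaj}(\pi)}u^{\operatorname{icomaj}(\pi)}v^{\operatorname{ides}(\pi)}.$$
   Context: A $k$-composition of $n$ is an ordered $k$-tuple $(\sigma_1,\ldots,\sigma_k)$ of positive integers with $\sigma_1+\cdots+\sigma_k=n$. $\mathbf{C}_k$ is the set of all $k$-compositions, for unrestricted $n$. $\mathbf{S}_k$ is the set of permutations $\pi=\pi_1\pi_2\cdots\pi_k$ of $\{1,\ldots,k\}$, regarded also as $k$-tuples; $\pi^{-1}$ is the inverse permutation ($\pi^{-1}_i=j$ when $\pi_j=i$). For $k=0$, $\mathbf{C}_0$ and $\mathbf{S}_0$ each consist of the empty tuple only, with all statistics equal to $0$. For a $k$-tuple $\alpha=(\alpha_1,\ldots,\alpha_k)$ of positive integers (repetitions allowed): $|\alpha|=\alpha_1+\cdots+\alpha_k$; $\operatorname{inv}(\alpha)$ is the number of pairs $(i,j)$ with $i<j$ and $\alpha_i>\alpha_j$; a descent of $\alpha$ is an index $i$ with $1\le i<k$ and $\alpha_i>\alpha_{i+1}$; $D(\alpha)$ is the set of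 descents; $\operatorname{des}(\alpha)=\#D(\alpha)$; $\operatorname{maj}(\alpha)=\sum_{i\in D(\alpha)}i$; $\operatorname{comaj}(\alpha)=\sum_{i\in D(\alpha)}(k-i)$. For a permutation $\pi$: $\operatorname{imaj}(\pi)=\operatorname{maj}(\pi^{-1})$, $\operatorname{icomaj}(\pi)=\operatorname{comaj}(\pi^{-1})$, $\operatorname{ides}(\pi)=\operatorname{des}(\pi^{-1})$. $(p)_k=(1-p)(1-p^2)\cdots(1-p^k)$, with $(p)_0=1$. *)

theory Defs
  imports "HOL-Analysis.Analysis" "HOL-Combinatorics.Combinatorics"
begin

text \<open>
  Tuples are lists of natural numbers, with entries numbered from 1 in the definitions below.
\<close>

definition entry :: "nat list \<Rightarrow> nat \<Rightarrow> nat" where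
  "entry \<alpha> i = \<alpha> ! (i - 1)"

definition compositions :: "nat \<Rightarrow> nat list set" where
  "compositions k = {\<sigma>. length \<sigma> = k \<and> (\<forall>i\<in>{1..k}. 0 < entry \<sigma> i)}"

definition perms :: "nat \<Rightarrow> nat list set" where
  "perms k = permutations_of_set {1..k}"

definition perm_inverse :: "nat list \<Rightarrow> nat list" where
  "perm_inverse \<pi> =
     map (\<lambda>i. THE j. j \<in> {1..length \<pi>} \<and> entry \<pi> j = i) [1..<Suc (length \<pi>)]"

definition inversions :: "nat list \<Rightarrow> nat" where
  "inversions \<alpha> =
     card {(i, j). 1 \<le> i \<and> i < j \<and> j \<le> length \<alpha> \<and> entry \<alpha> i > entry \<alpha> j}"

definition descents :: "nat list \<Rightarrow> nat set" where
  "descents \<alpha> = {i. 1 \<le> i \<and> i < length \<alpha> \<and> entry \<alpha> i > entry \<alpha> (i + 1)}"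

definition des :: "nat list \<Rightarrow> nat" where
  "des \<alpha> = card (descents \<alpha>)"

definition maj :: "nat list \<Rightarrow> nat" where
  "maj \<alpha> = (\<Sum>i\<in>descents \<alpha>. i)"

definition comaj :: "nat list \<Rightarrow> nat" where
  "comaj \<alpha> = (\<Sum>i\<in>descents \<alpha>. length \<alpha> - i)"

definition ides :: "nat list \<Rightarrow> nat" where
  "ides \<pi> = des (perm_inverse \<pi>)"

definition imaj :: "nat list \<Rightarrow> nat" where
  "imaj \<pi> = maj (perm_inverse \<pi>)"

definition icomaj :: "nat list \<Rightarrow> nat" where
  "icomaj \<pi> = comaj (perm_inverse \<pi>)"

text \<open>
  The ring \<open>\<int>[q,t,u,v]\<close> as the iterated polynomial ring \<open>\<int>[q][t][u][v]\<close>;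
  the indeterminate \<open>p\<close> is \<^const>\<open>fps_X\<close> over this ring.
\<close>

type_synonym coeff_ring = "int poly poly poly poly"

definition var_q :: coeff_ring where
  "var_q = [:[:[:[:0, 1:]:]:]:]"

definition var_t :: coeff_ring where
  "var_t = [:[:[:0, 1:]:]:]"

definition var_u :: coeff_ring where
  "var_u = [:[:0, 1:]:]"

definition var_v :: coeff_ring where
  "var_v = [:0, 1:]"

definition p_factorial :: "nat \<Rightarrow> coeff_ring fps" where
  "p_factorial k = (\<Prod>i=1..k. 1 - fps_X ^ i)"

text \<open>
  The class-based \<^const>\<open>inverse\<close> on power series needs an \<^const>\<open>inverse\<close> operation on the
  coefficients, which polynomials lack. The library's \<open>fps_right_inverse f y\<close>
  takes the inverse \<open>y\<close> of the constant coefficient explicitly; here it is 1.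
\<close>

definition inverse_p_factorial :: "nat \<Rightarrow> coeff_ring fps" where
  "inverse_p_factorial k = fps_right_inverse (p_factorial k) 1"

lemma p_factorial_mult_inverse: "p_factorial k * inverse_p_factorial k = 1"
proof -
  have "fps_nth (p_factorial k) 0 = 1"
    unfolding p_factorial_def by (induction k) auto
  then show ?thesis
    unfolding inverse_p_factorial_def by (intro fps_right_inverse) simp
qed

end

theory Submission
  imports Defs
begin

text \<open>
  Number the positions of a composition \<open>\<sigma>\<close> from the right and list them by decreasing value, equal
  values from right to left: this gives a permutation \<open>\<pi>\<close>, the reverse complement of the inverse of
  the standardization of \<open>\<sigma>\<close>. Ties are never descents or inversions, so \<open>inv \<sigma> = inv \<pi>\<close>, and the
  descents of \<open>\<sigma>\<close> are the numbers \<open>k - x\<close> with \<open>x\<close> a descent of the inverse of \<open>\<pi>\<close>; the reversal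
  \<open>x \<mapsto> k - x\<close> is what exchanges \<open>maj\<close> and \<open>comaj\<close>. The compositions with a given \<open>\<pi>\<close>
  correspond to the value sequences that are weakly decreasing along \<open>\<pi>\<close> and strictly so at each
  descent of \<open>\<pi>\<close>. Subtracting from each value 1 and the number of later descents leaves an arbitrary
  weakly decreasing sequence of length \<open>k\<close> and removes \<open>k + maj \<pi>\<close> from the sum. Weakly decreasing
  sequences have generating function \<open>1 / (p)\<^sub>k\<close>.
\<close>

section \<open>Weakly decreasing tuples\<close>

definition decreasing :: "nat \<Rightarrow> nat list set" where
  "decreasing k = {c. length c = k \<and> sorted_wrt (\<ge>) c}"

lemma finite_length_sum_list: "finite {c :: nat list. length c = k \<and> sum_list c = n}"
proof (rule finite_subset)
  show "{c :: nat list. length c = k \<and> sum_list c = n} \<subseteq> {c. set c \<subseteq> {..n} \<and> length c = k}"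
    using member_le_sum_list by fastforce
qed (simp add: finite_lists_length_eq)

lemma finite_decreasing: "finite {c \<in> decreasing k. sum_list c = n}"
  by (rule finite_subset[OF _ finite_length_sum_list[of k n]]) (auto simp: decreasing_def)

lemma sum_list_map_Suc: "sum_list (map Suc c) = sum_list c + length c"
  by (induction c) auto

lemma decreasing_split:
  "{c \<in> decreasing (Suc k). sum_list c = n} =
     (\<lambda>c. c @ [0]) ` {c \<in> decreasing k. sum_list c = n} \<union>
     map Suc ` {c \<in> decreasing (Suc k). sum_list c + Suc k = n}" (is "?L = ?A \<union> ?B")
proof
  show "?L \<subseteq> ?A \<union> ?B"
  proof
    fix c assume c: "c \<in> ?L"
    then have "c \<noteq> []" by (auto simp: decreasing_def)
    then obtain b x where bx: "c = b @ [x]" by (cases c rule: rev_cases) auto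
    show "c \<in> ?A \<union> ?B"
    proof (cases x)
      case 0
      then show ?thesis using c bx by (auto simp: decreasing_def sorted_wrt_append)
    next
      case (Suc y)
      define d where "d = map (\<lambda>x. x - 1) c"
      have pos: "\<forall>z\<in>set c. 0 < z"
        using c bx Suc by (auto simp: decreasing_def sorted_wrt_append)
      then have cd: "c = map Suc d"
        unfolding d_def by (simp add: map_idI)
      have "d \<in> decreasing (Suc k)"
        using c cd by (simp add: decreasing_def sorted_wrt_map)
      moreover have "sum_list d + Suc k = n"
        using c cd sum_list_map_Suc[of d] by (auto simp: decreasing_def)
      ultimately show ?thesis using cd by blast
    qed
  qed
  show "?A \<union> ?B \<subseteq> ?L"
    by (auto simp: decreasing_def sorted_wrt_append sorted_wrt_map sum_list_map_Suc)
qed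

definition decreasing_gf :: "nat \<Rightarrow> coeff_ring fps" where
  "decreasing_gf k = Abs_fps (\<lambda>n. of_nat (card {c \<in> decreasing k. sum_list c = n}))"

lemma card_decreasing_Suc:
  "card {c \<in> decreasing (Suc k). sum_list c = n} =
     card {c \<in> decreasing k. sum_list c = n} +
     card {c \<in> decreasing (Suc k). sum_list c + Suc k = n}"
proof -
  \<comment> \<open>The last entry tells the two images apart: 0 in the first, positive in the
    second.\<close>
  have "last (map Suc c) \<noteq> 0" if "c \<in> decreasing (Suc k)" for c
    using that by (cases c rule: rev_cases) (auto simp: decreasing_def)
  then have disj: "(\<lambda>c. c @ [0]) ` {c \<in> decreasing k. sum_list c = n} \<inter>
     map Suc ` {c \<in> decreasing (Suc k). sum_list c + Suc k = n} = {}"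
    by (smt (verit, best) disjoint_iff imageE last_snoc mem_Collect_eq)
  have fin: "finite {c \<in> decreasing (Suc k). sum_list c + Suc k = n}"
    by (rule finite_subset[OF _ finite_decreasing[of "Suc k" "n - Suc k"]]) auto
  show ?thesis
    unfolding decreasing_split
    using disj fin finite_decreasing[of k n]
    by (subst card_Un_disjoint) (auto simp: card_image inj_on_def)
qed

text \<open>Multiplication by \<open>fps_X ^ Suc k\<close> shifts coefficients, so this is the
  recurrence of the cardinalities; iterated, it produces the factors of
  \<open>p_factorial\<close>.\<close>

lemma decreasing_gf_Suc: "(1 - fps_X ^ Suc k) * decreasing_gf (Suc k) = decreasing_gf k"
proof (rule fps_ext)
  fix n
  have "{c \<in> decreasing (Suc k). sum_list c + Suc k = n} =
        (if n < Suc k then {} else {c \<in> decreasing (Suc k). sum_list c = n - Suc k})"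
    by auto
  then show "fps_nth ((1 - fps_X ^ Suc k) * decreasing_gf (Suc k)) n = fps_nth (decreasing_gf k) n"
    using card_decreasing_Suc[of k n]
    by (simp add: left_diff_distrib fps_X_power_mult_nth decreasing_gf_def del: power_Suc)
qed

lemma decreasing_gf_0: "decreasing_gf 0 = 1"
proof (rule fps_ext)
  fix n
  have "{c \<in> decreasing 0. sum_list c = n} = (if n = 0 then {[]} else {})"
    by (auto simp: decreasing_def)
  then show "fps_nth (decreasing_gf 0) n = fps_nth 1 n"
    by (simp add: decreasing_gf_def)
qed

lemma p_factorial_mult_decreasing_gf: "p_factorial k * decreasing_gf k = 1"
proof (induction k)
  case 0
  then show ?case by (simp add: p_factorial_def decreasing_gf_0)
next
  case (Suc k)
  have "p_factorial (Suc k) = p_factorial k * (1 - fps_X ^ Suc k)"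
    by (simp add: p_factorial_def)
  then show ?case
    using Suc decreasing_gf_Suc[of k] by (simp add: mult.assoc del: power_Suc)
qed

text \<open>Both series are inverse to \<open>p_factorial k\<close>, and inverses in a commutative
  ring are unique.\<close>

lemma inverse_p_factorial_eq: "inverse_p_factorial k = decreasing_gf k"
proof -
  have "inverse_p_factorial k = (p_factorial k * decreasing_gf k) * inverse_p_factorial k"
    by (simp only: p_factorial_mult_decreasing_gf mult_1_left)
  also have "\<dots> = (p_factorial k * inverse_p_factorial k) * decreasing_gf k"
    by (simp only: mult_ac)
  finally show ?thesis
    by (simp only: p_factorial_mult_inverse mult_1_left)
qed

section \<open>Permutations and their inverses\<close>

lemma perms_iff: "\<pi> \<in> perms k \<longleftrightarrow> distinct \<pi> \<and> set \<pi> = {1..k}"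
  unfolding perms_def permutations_of_set_def by blast

lemma perms_length: "\<pi> \<in> perms k \<Longrightarrow> length \<pi> = k"
  by (metis card_atLeastAtMost diff_Suc_1 distinct_card perms_iff)

lemma perms_nth: "\<pi> \<in> perms k \<Longrightarrow> i < k \<Longrightarrow> 1 \<le> \<pi> ! i \<and> \<pi> ! i \<le> k"
  using nth_mem[of i \<pi>] by (auto simp: perms_iff perms_length)

lemma length_perm_inverse: "length (perm_inverse \<pi>) = length \<pi>"
  by (simp add: perm_inverse_def del: upt_Suc)

text \<open>Entries are numbered from 1 and list indices from 0, hence \<open>Suc i\<close>.
  Distinctness of \<open>\<pi>\<close> makes the index unique, so the description operator picks
  it.\<close>

lemma entry_perm_inverse_nth:
  assumes "\<pi> \<in> perms k" "i < k"
  shows "entry (perm_inverse \<pi>) (\<pi> ! i) = Suc i"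
proof -
  have len: "length \<pi> = k" using assms perms_length by simp
  have "(THE j. j \<in> {1..length \<pi>} \<and> entry \<pi> j = \<pi> ! i) = Suc i"
  proof (rule the_equality)
    show "Suc i \<in> {1..length \<pi>} \<and> entry \<pi> (Suc i) = \<pi> ! i"
      using assms len by (simp add: entry_def)
    fix j assume j: "j \<in> {1..length \<pi>} \<and> entry \<pi> j = \<pi> ! i"
    then have "j - 1 = i"
      using assms len nth_eq_iff_index_eq[of \<pi> "j - 1" i] by (auto simp: perms_iff entry_def)
    then show "j = Suc i" using j by auto
  qed
  moreover have "\<pi> ! i - 1 < length \<pi>" "Suc (\<pi> ! i - 1) = \<pi> ! i"
    using perms_nth[OF assms] len by auto
  ultimately show ?thesis
    unfolding perm_inverse_def entry_def[of _ "\<pi> ! i"] by (simp del: upt_Suc)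
qed

lemma perms_ex_index: "\<pi> \<in> perms k \<Longrightarrow> a \<in> {1..k} \<Longrightarrow> \<exists>i<k. \<pi> ! i = a"
  by (metis in_set_conv_nth perms_iff perms_length)

section \<open>The sorting permutation of a composition\<close>

text \<open>
  The positions of \<open>\<sigma>\<close> are numbered from the right by \<open>a = 1, \<dots>, k\<close>, position \<open>a\<close> holding
  \<open>\<sigma> ! (k - a)\<close>. Sorting by this key lists them by decreasing value, ties by increasing \<open>a\<close>; the
  factor \<open>Suc k\<close> exceeds every difference of two values of \<open>a\<close>.
\<close>

definition sort_position_key :: "nat list \<Rightarrow> nat \<Rightarrow> int" where
  "sort_position_key \<sigma> a = int a - int (Suc (length \<sigma>)) * int (\<sigma> ! (length \<sigma> - a))"

definition sorts :: "nat list \<Rightarrow> nat list \<Rightarrow> bool" where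
  "sorts \<pi> \<sigma> \<longleftrightarrow> sorted_wrt (<) (map (sort_position_key \<sigma>) \<pi>)"

lemma sort_position_key_less_iff:
  assumes "a \<le> length \<sigma>" "b \<le> length \<sigma>"
  shows "sort_position_key \<sigma> a < sort_position_key \<sigma> b \<longleftrightarrow>
    \<sigma> ! (length \<sigma> - a) > \<sigma> ! (length \<sigma> - b) \<or>
    \<sigma> ! (length \<sigma> - a) = \<sigma> ! (length \<sigma> - b) \<and> a < b"
proof -
  define k x y where "k = int (Suc (length \<sigma>))" and
    "x = int (\<sigma> ! (length \<sigma> - a))" and "y = int (\<sigma> ! (length \<sigma> - b))"
  have ab: "int a < k" "int b < k" "0 \<le> int a" "0 \<le> int b" using assms by (auto simp: k_def)
  have k: "0 < k" by (simp add: k_def)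
  have "k * y + k \<le> k * x" if "y < x"
    using mult_left_mono[of "y + 1" x k] that k by (simp add: algebra_simps)
  moreover have "k * x + k \<le> k * y" if "x < y"
    using mult_left_mono[of "x + 1" y k] that k by (simp add: algebra_simps)
  ultimately have "int a - k * x < int b - k * y \<longleftrightarrow> y < x \<or> x = y \<and> int a < int b"
    using ab by (cases x y rule: linorder_cases) auto
  then show ?thesis
    by (simp add: sort_position_key_def k_def x_def y_def)
qed

lemma inj_on_sort_position_key: "inj_on (sort_position_key \<sigma>) {..length \<sigma>}"
proof (rule inj_onI)
  fix a b assume "a \<in> {..length \<sigma>}" "b \<in> {..length \<sigma>}"
    and "sort_position_key \<sigma> a = sort_position_key \<sigma> b"
  then show "a = b"
    using sort_position_key_less_iff[of a \<sigma> b] sort_position_key_less_iff[of b \<sigma> a]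
    by (cases a b rule: linorder_cases) auto
qed

text \<open>The keys of the positions are pairwise distinct, so exactly one arrangement of them is
  strictly increasing. This splits the compositions into classes indexed by permutations.\<close>

lemma ex1_sorting_perm:
  assumes "length \<sigma> = k"
  shows "\<exists>!\<pi>. \<pi> \<in> perms k \<and> sorts \<pi> \<sigma>"
proof -
  have inj: "inj_on (sort_position_key \<sigma>) {1..k}"
    using assms by (intro inj_on_subset[OF inj_on_sort_position_key]) auto
  show ?thesis
  proof (rule ex_ex1I)
    let ?\<pi> = "sort_key (sort_position_key \<sigma>) [1..<Suc k]"
    have "set ?\<pi> = {1..k}" "distinct ?\<pi>" by auto
    then show "\<exists>\<pi>. \<pi> \<in> perms k \<and> sorts \<pi> \<sigma>"
      using inj by (intro exI[of _ ?\<pi>]) (simp add: perms_iff sorts_def strict_sorted_iff distinct_map)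
  next
    fix \<pi> \<rho> assume "\<pi> \<in> perms k \<and> sorts \<pi> \<sigma>" "\<rho> \<in> perms k \<and> sorts \<rho> \<sigma>"
    then have "set \<pi> = {1..k}" "set \<rho> = {1..k}"
      and "map (sort_position_key \<sigma>) \<pi> = map (sort_position_key \<sigma>) \<rho>"
      by (auto simp: perms_iff sorts_def intro!: strict_sorted_equal)
    then show "\<pi> = \<rho>"
      using inj by (metis inj_on_map_eq_map sup.idem)
  qed
qed

section \<open>Counts of later descents\<close>

definition descents_after :: "nat list \<Rightarrow> nat \<Rightarrow> nat" where
  "descents_after \<pi> i = card {j \<in> descents \<pi>. i < j}"

lemma finite_descents: "finite (descents \<pi>)"
  by (rule finite_subset[of _ "{..length \<pi>}"]) (auto simp: descents_def)

text \<open>List index \<open>i\<close> is position \<open>Suc i\<close>, so the count at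
  \<open>i\<close> includes a descent at that position itself. Moving one index to the right loses
  exactly this descent.\<close>

lemma descents_after_Suc:
  "descents_after \<pi> i = descents_after \<pi> (Suc i) + (if Suc i \<in> descents \<pi> then 1 else 0)"
proof -
  have "{j \<in> descents \<pi>. i < j} =
      (if Suc i \<in> descents \<pi> then insert (Suc i) {j \<in> descents \<pi>. Suc i < j}
       else {j \<in> descents \<pi>. Suc i < j})"
    by (auto simp: Suc_lessI) (metis Suc_lessI)
  then show ?thesis
    using finite_descents[of \<pi>] by (auto simp: descents_after_def)
qed

text \<open>Double counting: a descent \<open>j\<close> is counted at the \<open>j\<close> indices
  below it.\<close>

lemma sum_descents_after: "(\<Sum>i<length \<pi>. descents_after \<pi> i) = maj \<pi>"
proof -
  have "(\<Sum>i<length \<pi>. descents_after \<pi> i) =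
      (\<Sum>i<length \<pi>. \<Sum>j\<in>descents \<pi>. if i < j then 1 else 0)"
    by (simp add: descents_after_def sum.If_cases finite_descents Collect_conj_eq)
  also have "\<dots> = (\<Sum>j\<in>descents \<pi>. \<Sum>i<length \<pi>. if i < j then 1 else 0)"
    by (rule sum.swap)
  also have "\<dots> = (\<Sum>j\<in>descents \<pi>. j)"
  proof (rule sum.cong)
    fix j assume "j \<in> descents \<pi>"
    then have "{..<length \<pi>} \<inter> {i. i < j} = {..<j}" by (auto simp: descents_def)
    then show "(\<Sum>i<length \<pi>. if i < j then 1 else 0) = j" by (simp add: sum.If_cases)
  qed simp
  finally show ?thesis by (simp add: maj_def)
qed

section \<open>Compositions with a prescribed sorting permutation\<close>

definition unsort :: "nat list \<Rightarrow> nat list \<Rightarrow> nat list" where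
  "unsort \<pi> b = map (\<lambda>m. entry b (entry (perm_inverse \<pi>) (length \<pi> - m))) [0..<length \<pi>]"

lemma length_unsort [simp]: "length (unsort \<pi> b) = length \<pi>"
  by (simp add: unsort_def)

text \<open>The purpose of \<open>unsort\<close>: reading the result along \<open>\<pi>\<close>
  gives back \<open>b\<close>. Index \<open>m\<close> from the left is position
  \<open>length \<pi> - m\<close> from the right, and the inverse permutation finds where
  \<open>\<pi>\<close> lists that position.\<close>

lemma nth_unsort:
  assumes "\<pi> \<in> perms k" "i < k"
  shows "unsort \<pi> b ! (k - \<pi> ! i) = b ! i"
proof -
  have "k - (k - \<pi> ! i) = \<pi> ! i" "k - \<pi> ! i < k"
    using perms_nth[OF assms] by auto
  then show ?thesis
    using assms entry_perm_inverse_nth[OF assms] perms_length[OF assms(1)]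
    by (simp add: unsort_def entry_def)
qed

text \<open>As \<open>i\<close> varies, \<open>k - \<pi> ! i\<close> runs through all indices, so
  tuples may be compared in the order of \<open>\<pi>\<close>.\<close>

lemma nth_eqI_perms:
  assumes "\<pi> \<in> perms k" "length \<sigma> = k" "length \<tau> = k"
    and "\<And>i. i < k \<Longrightarrow> \<sigma> ! (k - \<pi> ! i) = \<tau> ! (k - \<pi> ! i)"
  shows "\<sigma> = \<tau>"
proof (rule nth_equalityI)
  fix m assume m: "m < length \<sigma>"
  then have "k - m \<in> {1..k}" using assms(2) by auto
  then obtain i where "i < k" "\<pi> ! i = k - m"
    using perms_ex_index[OF assms(1)] by blast
  then show "\<sigma> ! m = \<tau> ! m" using assms(4)[of i] m assms(2) by simp
qed (use assms in simp)

text \<open>By transitivity it is enough to compare neighbours in \<open>\<pi>\<close>. A tie of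
  values is allowed where the position numbers ascend; a descent of \<open>\<pi>\<close> forces a
  strict drop, hence the added 1.\<close>

lemma sorts_iff:
  assumes "\<pi> \<in> perms k" "length \<sigma> = k"
  shows "sorts \<pi> \<sigma> \<longleftrightarrow> (\<forall>i. Suc i < k \<longrightarrow>
    \<sigma> ! (k - \<pi> ! Suc i) + (if Suc i \<in> descents \<pi> then 1 else 0) \<le> \<sigma> ! (k - \<pi> ! i))"
proof -
  have "sort_position_key \<sigma> (\<pi> ! i) < sort_position_key \<sigma> (\<pi> ! Suc i) \<longleftrightarrow>
    \<sigma> ! (k - \<pi> ! Suc i) + (if Suc i \<in> descents \<pi> then 1 else 0) \<le> \<sigma> ! (k - \<pi> ! i)"
    if i: "Suc i < k" for i
  proof -
    have "\<pi> ! i \<noteq> \<pi> ! Suc i"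
      using assms i perms_length[OF assms(1)] by (simp add: perms_iff nth_eq_iff_index_eq)
    then have "Suc i \<in> descents \<pi> \<longleftrightarrow> \<not> \<pi> ! i < \<pi> ! Suc i"
      using i perms_length[OF assms(1)] by (auto simp: descents_def entry_def)
    then show ?thesis
      using sort_position_key_less_iff[of "\<pi> ! i" \<sigma> "\<pi> ! Suc i"]
        perms_nth[OF assms(1), of i] perms_nth[OF assms(1), of "Suc i"] i assms(2)
      by auto
  qed
  then show ?thesis
    unfolding sorts_def using perms_length[OF assms(1)]
    by (subst sorted_wrt_iff_nth_Suc_transp) auto
qed

text \<open>The staircase of later descents turns a weak decrease into one that is strict at the
  descents of \<open>\<pi>\<close>; the 1 makes all values positive.\<close>

definition from_pair :: "nat list \<Rightarrow> nat list \<Rightarrow> nat list" where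
  "from_pair \<pi> c = unsort \<pi> (map (\<lambda>i. c ! i + 1 + descents_after \<pi> i) [0..<length \<pi>])"

text \<open>Inverse of \<open>from_pair \<pi>\<close> on the compositions sorted by
  \<open>\<pi>\<close>. By \<open>descents_after_less\<close> the subtraction of naturals does not
  truncate there.\<close>

definition to_decreasing :: "nat list \<Rightarrow> nat list \<Rightarrow> nat list" where
  "to_decreasing \<pi> \<sigma> =
     map (\<lambda>i. \<sigma> ! (length \<pi> - \<pi> ! i) - (1 + descents_after \<pi> i)) [0..<length \<pi>]"

lemma nth_from_pair:
  assumes "\<pi> \<in> perms k" "i < k"
  shows "from_pair \<pi> c ! (k - \<pi> ! i) = c ! i + 1 + descents_after \<pi> i"
  using assms by (simp add: from_pair_def nth_unsort perms_length)

lemma length_from_pair: "length (from_pair \<pi> c) = length \<pi>"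
  by (simp add: from_pair_def)

lemma decreasing_iff:
  "c \<in> decreasing k \<longleftrightarrow> length c = k \<and> (\<forall>i. Suc i < k \<longrightarrow> c ! Suc i \<le> c ! i)"
  unfolding decreasing_def
  by (auto simp: sorted_wrt_iff_nth_Suc_transp)

lemma from_pair_sorts:
  assumes "\<pi> \<in> perms k" "c \<in> decreasing k"
  shows "sorts \<pi> (from_pair \<pi> c)"
proof -
  have "c ! Suc i \<le> c ! i \<and> descents_after \<pi> i =
      descents_after \<pi> (Suc i) + (if Suc i \<in> descents \<pi> then 1 else 0)" if "Suc i < k" for i
    using assms(2) that descents_after_Suc[of \<pi> i] by (simp add: decreasing_iff)
  then show ?thesis
    using assms by (simp add: sorts_iff[of _ k] length_from_pair perms_length nth_from_pair)
qed

lemma from_pair_compositions: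
  assumes "\<pi> \<in> perms k"
  shows "from_pair \<pi> c \<in> compositions k"
proof -
  have "0 < entry (from_pair \<pi> c) m" if m: "1 \<le> m" "m \<le> k" for m
  proof -
    have "Suc k - m \<in> {1..k}" using m by auto
    then obtain i where "i < k" "\<pi> ! i = Suc k - m"
      using perms_ex_index[OF assms] by blast
    then show ?thesis
      using nth_from_pair[OF assms, of i c] m by (auto simp: entry_def)
  qed
  then show ?thesis
    using assms by (simp add: compositions_def length_from_pair perms_length)
qed

lemma to_decreasing_from_pair:
  assumes "\<pi> \<in> perms k" "length c = k"
  shows "to_decreasing \<pi> (from_pair \<pi> c) = c"
  using assms by (intro nth_equalityI) (simp_all add: to_decreasing_def perms_length nth_from_pair)

text \<open>Induction from the last index down: there no descent is left and the value is positive.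
  A step to the left raises the count only across a descent of \<open>\<pi>\<close>, where the value
  rises by at least 1 as well.\<close>

lemma descents_after_less:
  assumes "\<pi> \<in> perms k" "\<sigma> \<in> compositions k" "sorts \<pi> \<sigma>" "i < k"
  shows "descents_after \<pi> i < \<sigma> ! (k - \<pi> ! i)"
proof -
  have len: "length \<sigma> = k" using assms by (simp add: compositions_def)
  have "i \<le> k - 1" using assms by simp
  then show ?thesis
  proof (induction rule: inc_induct)
    case base
    have "descents_after \<pi> (k - 1) = 0"
      using perms_length[OF assms(1)] by (auto simp: descents_after_def descents_def)
    moreover have "0 < \<sigma> ! (k - \<pi> ! (k - 1))"
      using assms(2) perms_nth[OF assms(1), of "k - 1"] assms(4)
      by (auto simp: compositions_def entry_def dest: bspec[of _ _ "Suc (k - \<pi> ! (k - 1))"])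
    ultimately show ?case by simp
  next
    case (step n)
    then have "Suc n < k" by simp
    then show ?case
      using step assms(3) unfolding sorts_iff[OF assms(1) len]
      by (subst descents_after_Suc) fastforce
  qed
qed

lemma from_pair_to_decreasing:
  assumes "\<pi> \<in> perms k" "\<sigma> \<in> compositions k" "sorts \<pi> \<sigma>"
  shows "from_pair \<pi> (to_decreasing \<pi> \<sigma>) = \<sigma>"
proof (rule nth_eqI_perms[OF assms(1)])
  fix i assume "i < k"
  then show "from_pair \<pi> (to_decreasing \<pi> \<sigma>) ! (k - \<pi> ! i) = \<sigma> ! (k - \<pi> ! i)"
    using assms descents_after_less[OF assms, of i]
    by (simp add: nth_from_pair to_decreasing_def perms_length)
qed (use assms in \<open>simp_all add: compositions_def length_from_pair perms_length\<close>)

lemma to_decreasing_decreasing: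
  assumes "\<pi> \<in> perms k" "\<sigma> \<in> compositions k" "sorts \<pi> \<sigma>"
  shows "to_decreasing \<pi> \<sigma> \<in> decreasing k"
proof -
  have len: "length \<sigma> = k" using assms by (simp add: compositions_def)
  have "to_decreasing \<pi> \<sigma> ! Suc i \<le> to_decreasing \<pi> \<sigma> ! i" if i: "Suc i < k" for i
    using assms(3) i descents_after_less[OF assms, of i] descents_after_less[OF assms, of "Suc i"]
      descents_after_Suc[of \<pi> i]
    unfolding sorts_iff[OF assms(1) len]
    by (auto simp: to_decreasing_def perms_length[OF assms(1)] dest!: spec[of _ i])
  then show ?thesis
    by (simp add: decreasing_iff to_decreasing_def perms_length[OF assms(1)])
qed

section \<open>Statistics\<close>

lemma sum_list_from_pair:
  assumes "\<pi> \<in> perms k" "length c = k"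
  shows "sum_list (from_pair \<pi> c) = k + maj \<pi> + sum_list c"
proof -
  let ?\<sigma> = "from_pair \<pi> c"
  have len: "length \<pi> = k" using assms perms_length by simp
  have "sum_list ?\<sigma> = (\<Sum>m<k. ?\<sigma> ! m)"
    by (simp add: sum_list_sum_nth length_from_pair len atLeast0LessThan)
  \<comment> \<open>The sum is reordered by position number from the right and then along
    \<open>\<pi>\<close>, where the values are known.\<close>
  also have "\<dots> = (\<Sum>a\<in>{1..k}. ?\<sigma> ! (k - a))"
    by (rule sum.reindex_bij_witness[of _ "\<lambda>a. k - a" "\<lambda>m. k - m"]) auto
  also have "\<dots> = (\<Sum>a\<leftarrow>\<pi>. ?\<sigma> ! (k - a))"
    using assms by (simp add: perms_iff sum_list_distinct_conv_sum_set)
  also have "\<dots> = (\<Sum>i<k. ?\<sigma> ! (k - \<pi> ! i))"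
    by (simp add: sum_list_sum_nth len atLeast0LessThan)
  also have "\<dots> = (\<Sum>i<k. c ! i + 1 + descents_after \<pi> i)"
    using assms by (simp add: nth_from_pair)
  also have "\<dots> = k + maj \<pi> + sum_list c"
    using sum_descents_after[of \<pi>] assms len
    by (simp add: sum.distrib sum_list_sum_nth atLeast0LessThan del: add_Suc_right One_nat_def)
  finally show ?thesis .
qed

text \<open>Among equal values, \<open>\<pi>\<close> lists the rightmost position first, so a tie gives \<open>j < i\<close>.\<close>

lemma sorts_greater_iff:
  assumes "\<pi> \<in> perms k" "length \<sigma> = k" "sorts \<pi> \<sigma>" "i < k" "j < k" "\<pi> ! j < \<pi> ! i"
  shows "\<sigma> ! (k - \<pi> ! i) > \<sigma> ! (k - \<pi> ! j) \<longleftrightarrow> i < j"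
proof -
  have len: "length \<pi> = k" using assms perms_length by simp
  have "sort_position_key \<sigma> (\<pi> ! x) < sort_position_key \<sigma> (\<pi> ! y)" if "x < y" "y < k" for x y
    using assms(3) that len by (simp add: sorts_def sorted_wrt_iff_nth_less)
  moreover have "i \<noteq> j" using assms by auto
  ultimately show ?thesis
    using assms(2,4,5,6) perms_nth[OF assms(1)] sort_position_key_less_iff[of "\<pi> ! i" \<sigma> "\<pi> ! j"]
      sort_position_key_less_iff[of "\<pi> ! j" \<sigma> "\<pi> ! i"]
    by (cases i j rule: linorder_cases) fastforce+
qed

text \<open>The position numbered \<open>entry \<pi> i\<close> from the right is \<open>?s i\<close>
  from the left, and \<open>?p\<close> undoes this. The two conditions of an inversion are
  exchanged: the larger entry of \<open>\<pi>\<close> becomes the earlier position of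
  \<open>\<sigma>\<close>, and its earlier index then means the larger value.\<close>

lemma inversions_sorts:
  assumes "\<pi> \<in> perms k" "length \<sigma> = k" "sorts \<pi> \<sigma>"
  shows "inversions \<sigma> = inversions \<pi>"
proof -
  let ?p = "\<lambda>x. entry (perm_inverse \<pi>) (Suc k - x)"
  let ?s = "\<lambda>i. Suc k - entry \<pi> i"
  have len: "length \<pi> = k" using assms perms_length by simp
  have s: "?p (?s i) = i" "1 \<le> ?s i" "?s i \<le> k" "entry \<sigma> (?s i) = \<sigma> ! (k - entry \<pi> i)"
    if i: "1 \<le> i" "i \<le> k" for i
  proof -
    have "i - 1 < k" using i by simp
    note facts = perms_nth[OF assms(1) this] entry_perm_inverse_nth[OF assms(1) this]
    show "?p (?s i) = i" "1 \<le> ?s i" "?s i \<le> k" "entry \<sigma> (?s i) = \<sigma> ! (k - entry \<pi> i)"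
      using facts i by (auto simp: entry_def)
  qed
  have p: "\<exists>i. x = ?s i \<and> 1 \<le> i \<and> i \<le> k" if x: "1 \<le> x" "x \<le> k" for x
  proof -
    have "Suc k - x \<in> {1..k}" using x by auto
    then obtain i where "i < k" "\<pi> ! i = Suc k - x"
      using perms_ex_index[OF assms(1)] by blast
    then show ?thesis using x by (intro exI[of _ "Suc i"]) (auto simp: entry_def)
  qed
  have main: "?s i < ?s j \<and> entry \<sigma> (?s i) > entry \<sigma> (?s j) \<longleftrightarrow>
      i < j \<and> entry \<pi> i > entry \<pi> j" if ij: "1 \<le> i" "i \<le> k" "1 \<le> j" "j \<le> k" for i j
  proof -
    have "?s i < ?s j \<longleftrightarrow> entry \<pi> j < entry \<pi> i"
      using s(2)[of i] s(2)[of j] ij by linarith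
    moreover have "\<sigma> ! (k - entry \<pi> i) > \<sigma> ! (k - entry \<pi> j) \<longleftrightarrow> i < j"
      if "entry \<pi> j < entry \<pi> i"
    proof -
      have "i - 1 < k" "j - 1 < k" "i - 1 < j - 1 \<longleftrightarrow> i < j" using ij by linarith+
      then show ?thesis
        using sorts_greater_iff[OF assms, of "i - 1" "j - 1"] that unfolding entry_def by blast
    qed
    ultimately show ?thesis
      using s(4)[of i] s(4)[of j] ij by metis
  qed
  have "bij_betw (\<lambda>(i, j). (?s i, ?s j))
      {(i, j). 1 \<le> i \<and> i < j \<and> j \<le> k \<and> entry \<pi> i > entry \<pi> j}
      {(i, j). 1 \<le> i \<and> i < j \<and> j \<le> k \<and> entry \<sigma> i > entry \<sigma> j}" (is "bij_betw ?f ?A ?B")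
  proof (rule bij_betw_imageI)
    show "inj_on ?f ?A"
      by (rule inj_on_inverseI[of _ "\<lambda>(x, y). (?p x, ?p y)"]) (auto simp: s)
    show "?f ` ?A = ?B"
    proof
      show "?f ` ?A \<subseteq> ?B"
      proof
        fix z assume "z \<in> ?f ` ?A"
        then obtain i j where "z = (?s i, ?s j)" "1 \<le> i" "i < j" "j \<le> k" "entry \<pi> j < entry \<pi> i"
          by (elim imageE) (simp add: split_beta)
        then show "z \<in> ?B"
          using main[of i j] s(2)[of i] s(3)[of j] by simp
      qed
      show "?B \<subseteq> ?f ` ?A"
      proof
        fix z assume "z \<in> ?B"
        then obtain x y where xy: "z = (x, y)" "1 \<le> x" "x < y" "y \<le> k" "entry \<sigma> y < entry \<sigma> x"
          by blast
        then obtain i j where ij: "x = ?s i" "1 \<le> i" "i \<le> k" "y = ?s j" "1 \<le> j" "j \<le> k"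
          using p[of x] p[of y] by (meson less_imp_le less_le_trans order_trans)
        then have "(i, j) \<in> ?A" using main[of i j] xy by simp
        then show "z \<in> ?f ` ?A" using ij xy(1) by (intro image_eqI[of _ _ "(i, j)"]) simp_all
      qed
    qed
  qed
  then show ?thesis
    unfolding inversions_def assms(2) len by (rule bij_betw_same_card[symmetric])
qed

text \<open>Positions \<open>x\<close> and \<open>x + 1\<close> of \<open>\<sigma>\<close> are
  numbered \<open>k - x + 1\<close> and \<open>k - x\<close> from the right. The value drops there
  exactly when \<open>\<pi>\<close> lists \<open>k - x + 1\<close> before \<open>k - x\<close>,
  which is a descent of the inverse at \<open>k - x\<close>.\<close>

lemma descents_sorts:
  assumes "\<pi> \<in> perms k" "length \<sigma> = k" "sorts \<pi> \<sigma>"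
  shows "bij_betw (\<lambda>x. k - x) (descents (perm_inverse \<pi>)) (descents \<sigma>)"
proof -
  have len: "length \<pi> = k" using assms perms_length by simp
  have main: "x \<in> descents \<sigma> \<longleftrightarrow> k - x \<in> descents (perm_inverse \<pi>)"
    if x: "1 \<le> x" "x < k" for x
  proof -
    have "Suc k - x \<in> {1..k}" "k - x \<in> {1..k}" using x by auto
    then obtain i j where i: "i < k" "\<pi> ! i = Suc k - x" and j: "j < k" "\<pi> ! j = k - x"
      using perms_ex_index[OF assms(1)] by meson
    have "entry (perm_inverse \<pi>) (k - x + 1) = Suc i" "entry (perm_inverse \<pi>) (k - x) = Suc j"
      using entry_perm_inverse_nth[OF assms(1)] i j x by (metis Suc_diff_le Suc_eq_plus1 less_imp_le)+
    moreover have "1 \<le> k - x" "k - x < k" using x by linarith+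
    ultimately have "k - x \<in> descents (perm_inverse \<pi>) \<longleftrightarrow> i < j"
      using len by (simp add: descents_def length_perm_inverse)
    also have "\<dots> \<longleftrightarrow> \<sigma> ! (k - \<pi> ! i) > \<sigma> ! (k - \<pi> ! j)"
      using sorts_greater_iff[OF assms i(1) j(1)] i j x by auto
    also have "\<dots> \<longleftrightarrow> x \<in> descents \<sigma>"
      using i j x assms(2) by (simp add: descents_def entry_def Suc_diff_le)
    finally show ?thesis by simp
  qed
  show ?thesis
  proof (rule bij_betw_byWitness[where f' = "\<lambda>x. k - x"])
    show "(\<lambda>x. k - x) ` descents (perm_inverse \<pi>) \<subseteq> descents \<sigma>"
    proof clarify
      fix x assume "x \<in> descents (perm_inverse \<pi>)"
      moreover from this have "1 \<le> x" "x < k"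
        by (auto simp: descents_def length_perm_inverse len)
      ultimately show "k - x \<in> descents \<sigma>"
        using main[of "k - x"] by simp
    qed
    show "(\<lambda>x. k - x) ` descents \<sigma> \<subseteq> descents (perm_inverse \<pi>)"
      using main assms(2) by (auto simp: descents_def)
  qed (use assms in \<open>auto simp: descents_def length_perm_inverse len\<close>)
qed

lemma des_sorts:
  assumes "\<pi> \<in> perms k" "length \<sigma> = k" "sorts \<pi> \<sigma>"
  shows "des \<sigma> = ides \<pi>"
  using bij_betw_same_card[OF descents_sorts[OF assms]] by (simp add: des_def ides_def)

lemma maj_sorts:
  assumes "\<pi> \<in> perms k" "length \<sigma> = k" "sorts \<pi> \<sigma>"
  shows "maj \<sigma> = icomaj \<pi>"
  using sum.reindex_bij_betw[OF descents_sorts[OF assms], of "\<lambda>x. x"] assms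
  by (simp add: maj_def icomaj_def comaj_def length_perm_inverse perms_length)

lemma comaj_sorts:
  assumes "\<pi> \<in> perms k" "length \<sigma> = k" "sorts \<pi> \<sigma>"
  shows "comaj \<sigma> = imaj \<pi>"
proof -
  have "comaj \<sigma> = (\<Sum>x\<in>descents (perm_inverse \<pi>). k - (k - x))"
    using sum.reindex_bij_betw[OF descents_sorts[OF assms], of "\<lambda>x. k - x"] assms
    by (simp add: comaj_def)
  also have "\<dots> = imaj \<pi>"
    unfolding imaj_def maj_def
    by (rule sum.cong) (use assms in \<open>auto simp: descents_def length_perm_inverse perms_length\<close>)
  finally show ?thesis .
qed

section \<open>The generating function\<close>

text \<open>The unique sorting permutation of the image recovers \<open>\<pi>\<close>, and
  \<open>to_decreasing\<close> then recovers \<open>c\<close>. Conversely, any composition is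
  reached by sorting it and subtracting the staircase.\<close>

lemma from_pair_bij:
  "bij_betw (\<lambda>(\<pi>, c). from_pair \<pi> c)
     (SIGMA \<pi>:perms k. {c \<in> decreasing k. k + maj \<pi> + sum_list c = n})
     {\<sigma> \<in> compositions k. sum_list \<sigma> = n}" (is "bij_betw ?f ?A ?B")
proof (rule bij_betw_imageI)
  show "inj_on ?f ?A"
  proof (rule inj_onI, clarify)
    fix \<pi> c \<pi>' c'
    assume a: "\<pi> \<in> perms k" "\<pi>' \<in> perms k" "c \<in> decreasing k" "c' \<in> decreasing k"
      and eq: "from_pair \<pi> c = from_pair \<pi>' c'"
    have "length (from_pair \<pi> c) = k" using a by (simp add: length_from_pair perms_length)
    then have "\<pi> = \<pi>'"
      using ex1_sorting_perm a eq from_pair_sorts by metis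
    then show "\<pi> = \<pi>' \<and> c = c'"
      using a eq to_decreasing_from_pair[of \<pi> k] by (metis decreasing_iff)
  qed
  show "?f ` ?A = ?B"
  proof
    show "?f ` ?A \<subseteq> ?B"
      by (auto simp: from_pair_compositions sum_list_from_pair decreasing_iff)
    show "?B \<subseteq> ?f ` ?A"
    proof
      fix \<sigma> assume \<sigma>: "\<sigma> \<in> ?B"
      then obtain \<pi> where \<pi>: "\<pi> \<in> perms k" "sorts \<pi> \<sigma>"
        using ex1_sorting_perm[of \<sigma> k] by (auto simp: compositions_def)
      define c where "c = to_decreasing \<pi> \<sigma>"
      have c: "c \<in> decreasing k" "from_pair \<pi> c = \<sigma>"
        using \<sigma> \<pi> to_decreasing_decreasing from_pair_to_decreasing by (auto simp: c_def)
      then have "(\<pi>, c) \<in> ?A"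
        using \<sigma> \<pi> sum_list_from_pair[of \<pi> k c] by (auto simp: decreasing_iff)
      then show "\<sigma> \<in> ?f ` ?A" using c by force
    qed
  qed
qed

lemma finite_compositions_sum: "finite {\<sigma> \<in> compositions k. sum_list \<sigma> = n}"
  by (rule finite_subset[OF _ finite_length_sum_list[of k n]]) (auto simp: compositions_def)

theorem theorem10:
  fixes k :: nat
  shows "((\<lambda>\<sigma>. fps_X ^ sum_list \<sigma> *
             fps_const (var_q ^ inversions \<sigma> * var_t ^ comaj \<sigma> *
                        var_u ^ maj \<sigma> * var_v ^ des \<sigma>))
          has_sum
          fps_X ^ k * inverse_p_factorial k *
            (\<Sum>\<pi>\<in>perms k. fps_X ^ maj \<pi> *
               fps_const (var_q ^ inversions \<pi> * var_t ^ imaj \<pi> *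
                          var_u ^ icomaj \<pi> * var_v ^ ides \<pi>)))
         (compositions k)"
proof -
  define w where "w \<sigma> = var_q ^ inversions \<sigma> * var_t ^ comaj \<sigma> * var_u ^ maj \<sigma> * var_v ^ des \<sigma>"
    for \<sigma>
  define w' where "w' \<pi> = var_q ^ inversions \<pi> * var_t ^ imaj \<pi> * var_u ^ icomaj \<pi> * var_v ^ ides \<pi>"
    for \<pi>
  have w: "w (from_pair \<pi> c) = w' \<pi>" if "\<pi> \<in> perms k" "c \<in> decreasing k" for \<pi> c
    using inversions_sorts comaj_sorts maj_sorts des_sorts from_pair_sorts[OF that] that
    by (simp add: w_def w'_def length_from_pair perms_length)
  have nth: "fps_nth (fps_X ^ m * fps_const x) n = (if m = n then x else 0)" for m n and x :: coeff_ring
    by (auto simp: fps_X_power_mult_nth)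
  have coeff: "fps_nth (fps_X ^ k * decreasing_gf k * (\<Sum>\<pi>\<in>perms k. fps_X ^ maj \<pi> * fps_const (w' \<pi>))) n
      = (\<Sum>\<sigma> | \<sigma> \<in> compositions k \<and> sum_list \<sigma> = n. w \<sigma>)" for n
  proof -
    \<comment> \<open>Below \<open>k + maj \<pi>\<close> the truncated difference would be 0 and
      admit the zero tuple, so that case is separate. The split matches the coefficient rule for
      multiplication by a power of \<open>fps_X\<close>.\<close>
    have set: "{c \<in> decreasing k. k + maj \<pi> + sum_list c = n} =
      (if n < k + maj \<pi> then {} else {c \<in> decreasing k. sum_list c = n - (k + maj \<pi>)})" for \<pi>
      by auto
    have fin: "finite {c \<in> decreasing k. k + maj \<pi> + sum_list c = n}" for \<pi>
      unfolding set by (simp add: finite_decreasing)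
    have "fps_X ^ k * decreasing_gf k * (\<Sum>\<pi>\<in>perms k. fps_X ^ maj \<pi> * fps_const (w' \<pi>)) =
        (\<Sum>\<pi>\<in>perms k. fps_X ^ (k + maj \<pi>) * (decreasing_gf k * fps_const (w' \<pi>)))"
      by (simp add: sum_distrib_left power_add mult_ac)
    then have "fps_nth (fps_X ^ k * decreasing_gf k *
          (\<Sum>\<pi>\<in>perms k. fps_X ^ maj \<pi> * fps_const (w' \<pi>))) n =
        (\<Sum>\<pi>\<in>perms k. fps_nth (fps_X ^ (k + maj \<pi>) * (decreasing_gf k * fps_const (w' \<pi>))) n)"
      by (simp add: fps_sum_nth)
    \<comment> \<open>The coefficient of \<open>decreasing_gf k\<close> is a cardinality, so its
      product with \<open>w' \<pi>\<close> is a constant sum over the tuples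
      \<open>c\<close>.\<close>
    also have "\<dots> = (\<Sum>\<pi>\<in>perms k. \<Sum>c | c \<in> decreasing k \<and> k + maj \<pi> + sum_list c = n. w' \<pi>)"
      by (intro sum.cong refl) (auto simp: fps_X_power_mult_nth set decreasing_gf_def)
    also have "\<dots> = (\<Sum>\<pi>\<in>perms k. \<Sum>c | c \<in> decreasing k \<and> k + maj \<pi> + sum_list c = n.
        w (from_pair \<pi> c))"
      by (intro sum.cong refl) (simp add: w)
    also have "\<dots> = (\<Sum>(\<pi>, c)\<in>(SIGMA \<pi>:perms k. {c \<in> decreasing k. k + maj \<pi> + sum_list c = n}).
        w (from_pair \<pi> c))"
      by (rule sum.Sigma) (auto simp: perms_def fin)
    also have "\<dots> = (\<Sum>\<sigma> | \<sigma> \<in> compositions k \<and> sum_list \<sigma> = n. w \<sigma>)"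
      using sum.reindex_bij_betw[OF from_pair_bij[of k n], of w] by (simp add: case_prod_unfold)
    finally show ?thesis .
  qed
  have "((\<lambda>\<sigma>. fps_X ^ sum_list \<sigma> * fps_const (w \<sigma>)) has_sum
      fps_X ^ k * decreasing_gf k * (\<Sum>\<pi>\<in>perms k. fps_X ^ maj \<pi> * fps_const (w' \<pi>)))
      (compositions k)"
  \<comment> \<open>Convergence is checked coefficientwise: only finitely many compositions
    contribute to each coefficient.\<close>
  proof (rule has_sum_fpsI)
    fix n
    have sub: "{\<sigma> \<in> compositions k. fps_nth (fps_X ^ sum_list \<sigma> * fps_const (w \<sigma>)) n \<noteq> 0}
        \<subseteq> {\<sigma> \<in> compositions k. sum_list \<sigma> = n}"
      by (auto simp: nth split: if_splits)
    show "finite {\<sigma> \<in> compositions k. fps_nth (fps_X ^ sum_list \<sigma> * fps_const (w \<sigma>)) n \<noteq> 0}"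
      using sub finite_compositions_sum by (rule finite_subset)
    show "fps_nth (fps_X ^ k * decreasing_gf k *
          (\<Sum>\<pi>\<in>perms k. fps_X ^ maj \<pi> * fps_const (w' \<pi>))) n =
        (\<Sum>\<sigma> | \<sigma> \<in> compositions k \<and> fps_nth (fps_X ^ sum_list \<sigma> * fps_const (w \<sigma>)) n \<noteq> 0.
          fps_nth (fps_X ^ sum_list \<sigma> * fps_const (w \<sigma>)) n)"
      \<comment> \<open>Compositions of \<open>n\<close> outside the support contribute zero, so
        both index sets give the same sum without deciding whether \<open>w\<close>
        vanishes.\<close>
      unfolding coeff
      by (rule sum.mono_neutral_cong_right[OF finite_compositions_sum sub]) (auto simp: nth split: if_splits)
  qed
  then show ?thesis
    unfolding w_def w'_def inverse_p_factorial_eq .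
qed

end
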